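(* Let $\beta_0=\{q_0,q_1,q_2,p_0,p_1,p_2\}$ with $p_2=F_2F_1q_0$, $p_1=F_1F_0q_2$, $p_0=F_0F_2q_1$. Then the conductances of $\beta_0$ are, for $i\ne j$ in $\{0,1,2\}$, $$c_{q_i,p_i}=\frac{410}{159},\qquad c_{q_i,q_j}=\frac{5}{53},\qquad c_{q_i,p_j}=\frac{20}{53},\qquad c_{p_i,p_j}=\frac{80}{53}.$$
   Context: Let $q_0,q_1,q_2$ be the vertices of an equilateral triangle in the plane, $F_i(x)=\frac12(x+q_i)$, and let $SG$ (the Sierpinski gasket) be the unique nonempty compact set with $SG=\bigcup_{i}F_i(SG)$. For a word $w$ of length $m$ let $F_w=F_{w_1}\circ\cdots\circ F_{w_m}$. Put $V_0=\{q_0,q_1,q_2\}$, $V_m=\bigcup_iF_iV_{m-1}$; $x\sim_m y$ means $x\ne y$ and $x,y\in F_wV_0$ for some word $w$ of length $m$. The energy of a continuous $u:SG\to\mathbb{R}$ is $\mathcal{E}(u)=\lim_{m\to\infty}\left(\frac53\right)^m\sum_{\{x,y\}:x\sim_m y}(u(x)-u(y))^2$ (a nondecreasing limit), and $\operatorname{dom}\mathcal{E}$ is the set of continuous $u$ with $\mathcal{E}(u)<\infty$. For a nonempty set $A\subset V_m$ and values prescribed on $A$, there is a unique $u\in\operatorname{dom}\mathcal{E}$ of least energy with these values on $A$, and its energy has the form $\mathcal{E}(u)=\sum_{\{x,y\}\subset A}c_{x,y}(u(x)-u(y))^2$; the (uniquely determined, symmetric) coefficients $c_{x,y}$, $x\neq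 y$, are the conductances of $A$. *)

theory Defs
  imports "HOL-Analysis.Analysis"
begin

text \<open>The triple of corners is a map \<open>q :: nat \<Rightarrow> real^2\<close> of which only \<open>q 0, q 1, q 2\<close> are used;
  likewise letters are the naturals below 3.\<close>

definition equilateral :: "(nat \<Rightarrow> real^2) \<Rightarrow> bool" where
  "equilateral q \<longleftrightarrow>
     q 0 \<noteq> q 1 \<and> dist (q 0) (q 1) = dist (q 1) (q 2) \<and> dist (q 1) (q 2) = dist (q 2) (q 0)"

definition F :: "(nat \<Rightarrow> real^2) \<Rightarrow> nat \<Rightarrow> real^2 \<Rightarrow> real^2" where
  "F q i x = (1/2) *\<^sub>R (x + q i)"

definition SG :: "(nat \<Rightarrow> real^2) \<Rightarrow> (real^2) set" where
  "SG q = (THE K. K \<noteq> {} \<and> compact K \<and> K = (\<Union>i<3. F q i ` K))"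

definition F_word :: "(nat \<Rightarrow> real^2) \<Rightarrow> nat list \<Rightarrow> real^2 \<Rightarrow> real^2" where
  "F_word q w = foldr (F q) w"

definition V0 :: "(nat \<Rightarrow> real^2) \<Rightarrow> (real^2) set" where
  "V0 q = {q 0, q 1, q 2}"

definition adj :: "(nat \<Rightarrow> real^2) \<Rightarrow> nat \<Rightarrow> real^2 \<Rightarrow> real^2 \<Rightarrow> bool" where
  "adj q m x y \<longleftrightarrow> x \<noteq> y \<and>
     (\<exists>w. length w = m \<and> set w \<subseteq> {..<3} \<and> x \<in> F_word q w ` V0 q \<and> y \<in> F_word q w ` V0 q)"

text \<open>The sum over unordered pairs is half the sum over ordered pairs.\<close>

definition graph_energy :: "(nat \<Rightarrow> real^2) \<Rightarrow> nat \<Rightarrow> (real^2 \<Rightarrow> real) \<Rightarrow> real" where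
  "graph_energy q m u =
     (5/3)^m * ((1/2) * (\<Sum>(x,y)\<in>{(x,y). adj q m x y}. (u x - u y)\<^sup>2))"

definition energy :: "(nat \<Rightarrow> real^2) \<Rightarrow> (real^2 \<Rightarrow> real) \<Rightarrow> ereal" where
  "energy q u = lim (\<lambda>m. ereal (graph_energy q m u))"

text \<open>A function on \<open>SG q\<close> is represented by any extension of it to the plane; continuity is
  required on \<open>SG q\<close> only, and the energy depends only on the values there.\<close>

definition dom_energy :: "(nat \<Rightarrow> real^2) \<Rightarrow> (real^2 \<Rightarrow> real) set" where
  "dom_energy q = {u. continuous_on (SG q) u \<and> energy q u < \<infinity>}"

definition least_energy_ext ::
  "(nat \<Rightarrow> real^2) \<Rightarrow> (real^2) set \<Rightarrow> (real^2 \<Rightarrow> real) \<Rightarrow> (real^2 \<Rightarrow> real) \<Rightarrow> bool" where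
  "least_energy_ext q A f u \<longleftrightarrow>
     u \<in> dom_energy q \<and> (\<forall>x\<in>A. u x = f x) \<and>
     (\<forall>v\<in>dom_energy q. (\<forall>x\<in>A. v x = f x) \<longrightarrow> energy q u \<le> energy q v)"

text \<open>The conductances are determined only at pairs of distinct points of \<open>A\<close>; setting them to 0
  elsewhere makes them a unique function, so that they can be picked by a definite description.
  All least energy extensions of the same data have the same energy, so quantifying existentially
  over them loses nothing and also demands that there is one.\<close>

definition is_conductances ::
  "(nat \<Rightarrow> real^2) \<Rightarrow> (real^2) set \<Rightarrow> (real^2 \<Rightarrow> real^2 \<Rightarrow> real) \<Rightarrow> bool" where
  "is_conductances q A c \<longleftrightarrow>
     (\<forall>x y. c x y = c y x) \<and>
     (\<forall>x y. \<not> (x \<in> A \<and> y \<in> A \<and> x \<noteq> y) \<longrightarrow> c x y = 0) \<and>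
     (\<forall>f. \<exists>u. least_energy_ext q A f u \<and>
        energy q u = ereal ((1/2) * (\<Sum>x\<in>A. \<Sum>y\<in>A. c x y * (u x - u y)\<^sup>2)))"

definition conductance ::
  "(nat \<Rightarrow> real^2) \<Rightarrow> (real^2) set \<Rightarrow> real^2 \<Rightarrow> real^2 \<Rightarrow> real" where
  "conductance q A = (THE c. is_conductances q A c)"

end

(* Energies at level m+1 are sums over the three cells of energies at level m, so they are
   nondecreasing in m, with equality for functions extended by the harmonic 1/5-2/5 rule.
   Hence every function has energy at least its level-2 graph energy, with equality for a
   function harmonic on the level-2 cells, and the conductances of beta_0 are those of the
   15-vertex network of level 2 with the 9 vertices outside beta_0 eliminated. The elimination
   is done by completing squares, first inside the three cells of level 1 (two vertices each),
   then at the three points joining these cells. Uniqueness of the conductances is polarization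
   of the minimal energy as a quadratic form. *)

theory Submission
  imports Defs
begin

section \<open>Barycentric coordinates of an equilateral triangle\<close>

lemma lessThan_3: "{..<3} = {0, 1, 2::nat}"
  by auto

lemma less_3_cases: "i < (3::nat) \<Longrightarrow> i = 0 \<or> i = 1 \<or> i = 2"
  by auto

lemma sum_lessThan_3: "(\<Sum>i<3. f i) = f 0 + f 1 + f (2::nat)" for f :: "nat \<Rightarrow> 'a::comm_monoid_add"
  by (simp add: lessThan_3 add.assoc)

text \<open>Points of the plane enter the proof only through these coordinates, so that membership
  in cells and equality of vertices become arithmetic. Affinity is asked for midpoints, the form in
  which \<open>F\<close> uses it.\<close>

locale barycentric =
  fixes q :: "nat \<Rightarrow> real^2" and b :: "nat \<Rightarrow> real^2 \<Rightarrow> real"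
  assumes b_q: "\<And>i j. i < 3 \<Longrightarrow> j < 3 \<Longrightarrow> b i (q j) = of_bool (i = j)"
    and b_mid: "\<And>i x y. b i ((1/2) *\<^sub>R (x + y)) = (b i x + b i y) / 2"
    and b_sum: "\<And>x. (\<Sum>i<3. b i x) = 1"
    and b_cont: "\<And>i. continuous_on UNIV (b i)"
    and b_inj: "\<And>x y. (\<And>i. i < 3 \<Longrightarrow> b i x = b i y) \<Longrightarrow> x = y"

text \<open>The coordinates are ratios of signed areas. The equal side lengths serve to show that
  the area \<open>d\<close> of the whole triangle is nonzero.\<close>

lemma equilateral_barycentric:
  assumes "equilateral q"
  obtains b where "barycentric q b"
proof -
  \<comment> \<open>\<open>D\<close> is the planar cross product, so
    \<open>D (q 1 - x) (q 2 - x)\<close> is twice the signed area of the triangle with vertices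
    \<open>x\<close>, \<open>q 1\<close>, \<open>q 2\<close>.\<close>
  define D :: "real^2 \<Rightarrow> real^2 \<Rightarrow> real" where "D x y = x$1 * y$2 - x$2 * y$1" for x y
  define d where "d = D (q 1 - q 0) (q 2 - q 0)"
  define b where "b i x = (if i = 0 then D (q 1 - x) (q 2 - x) else if i = 1 then D (q 2 - x) (q 0 - x)
     else D (q 0 - x) (q 1 - x)) / d" for i :: nat and x
  have norms: "norm (q 1 - q 0) = norm (q 2 - q 0)" "norm (q 1 - q 0) = norm (q 2 - q 1)" "q 1 - q 0 \<noteq> 0"
    using assms by (auto simp: equilateral_def dist_norm norm_minus_commute)
  have n2: "norm v ^ 2 = v$1^2 + v$2^2" for v :: "real^2"
    by (simp add: norm_vec_def L2_set_def sum_2 real_sqrt_pow2)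
  define e1 e2 g1 g2 where "e1 = (q 1 - q 0)$1" and "e2 = (q 1 - q 0)$2"
    and "g1 = (q 2 - q 0)$1" and "g2 = (q 2 - q 0)$2"
  define L where "L = e1^2 + e2^2"
  have L: "L = g1^2 + g2^2" "L = (g1 - e1)^2 + (g2 - e2)^2"
    using n2[of "q 1 - q 0"] n2[of "q 2 - q 0"] n2[of "q 2 - q 1"] norms(1,2)
    by (auto simp: L_def e1_def e2_def g1_def g2_def)
  have "L \<noteq> 0"
    using norms(3) n2[of "q 1 - q 0"] by (auto simp: L_def e1_def e2_def)
  \<comment> \<open>The law of cosines for three sides of squared length \<open>L\<close>. With
    Lagrange's identity below it gives d^2 = (3/4) L^2.\<close>
  have "e1*g1 + e2*g2 = L / 2"
    using L L_def by (simp add: power2_eq_square algebra_simps)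
  moreover have "(e1*g2 - e2*g1)^2 + (e1*g1 + e2*g2)^2 = L * L"
  proof -
    have "(e1*g2 - e2*g1)^2 + (e1*g1 + e2*g2)^2 = (e1^2 + e2^2) * (g1^2 + g2^2)"
      by (simp add: power2_eq_square algebra_simps)
    then show ?thesis using L(1) L_def by simp
  qed
  moreover have "d = e1*g2 - e2*g1"
    by (simp add: d_def D_def e1_def e2_def g1_def g2_def)
  ultimately have "d^2 + (L/2)^2 = L * L"
    by metis
  then have "4 * d^2 = 3 * L^2"
    by (simp add: power2_eq_square)
  with \<open>L \<noteq> 0\<close> have d: "d \<noteq> 0" by auto
  have d': "d = q 1$1 * q 2$2 + q 2$1 * q 0$2 + q 0$1 * q 1$2 - q 1$2 * q 2$1 - q 2$2 * q 0$1 - q 0$2 * q 1$1"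
    by (simp add: d_def D_def algebra_simps)
  show ?thesis
  proof (rule that[of b], unfold_locales)
    show "b i (q j) = of_bool (i = j)" if "i < 3" "j < 3" for i j
      using less_3_cases[OF that(1)] less_3_cases[OF that(2)] d
      by (elim disjE) (simp_all add: b_def D_def, simp_all add: d' algebra_simps)
    show "b i ((1/2) *\<^sub>R (x + y)) = (b i x + b i y) / 2" for i x y
      using d by (auto simp: b_def D_def field_simps)
    show "(\<Sum>i<3. b i x) = 1" for x
    proof -
      have "D (q 1 - x) (q 2 - x) + D (q 2 - x) (q 0 - x) + D (q 0 - x) (q 1 - x) = d"
        by (simp add: D_def d' algebra_simps)
      with d show ?thesis by (simp add: sum_lessThan_3 b_def flip: add_divide_distrib)
    qed
    show "continuous_on UNIV (b i)" for i
      unfolding b_def D_def by (cases "i = 0"; cases "i = 1") (auto intro!: continuous_intros simp: d)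
    have *: "x$k = b 0 x * q 0$k + b 1 x * q 1$k + b 2 x * q 2$k" if "k = 1 \<or> k = 2" for x k
    proof -
      have "d * x$k = D (q 1 - x) (q 2 - x) * q 0$k + D (q 2 - x) (q 0 - x) * q 1$k + D (q 0 - x) (q 1 - x) * q 2$k"
        using that by (elim disjE) (simp_all add: D_def d' algebra_simps)
      with d show ?thesis by (simp add: b_def field_simps)
    qed
    show "x = y" if "\<And>i. i < 3 \<Longrightarrow> b i x = b i y" for x y
      using *[of 1 x] *[of 2 x] *[of 1 y] *[of 2 y] that[of 0] that[of 1] that[of 2]
      by (simp add: vec_eq_iff forall_2)
  qed
qed

section \<open>Cells, their overlaps, and gluing functions along them\<close>

context barycentric
begin

lemma b_F: "b i (F q j x) = (b i x + b i (q j)) / 2"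
  by (simp add: F_def b_mid[simplified])

lemma b_F': "i < 3 \<Longrightarrow> j < 3 \<Longrightarrow> b i (F q j x) = (b i x + of_bool (i = j)) / 2"
  by (simp add: b_F b_q)

lemma inj_F: "inj (F q i)"
  by (auto simp: inj_def F_def)

lemma F_q [simp]: "F q i (q i) = q i"
  by (simp add: F_def flip: scaleR_2)

lemma F_q_commute: "F q i (q j) = F q j (q i)"
  by (simp add: F_def add.commute)

lemma q_inject: "i < 3 \<Longrightarrow> j < 3 \<Longrightarrow> q i = q j \<longleftrightarrow> i = j"
  using b_q[of i i] b_q[of i j] by (auto split: if_splits)

definition triangle :: "(real^2) set" where
  "triangle = {x. \<forall>i<3. b i x \<ge> 0}"

lemma closed_triangle: "closed triangle"
proof -
  have "triangle = (\<Inter>i\<in>{..<3}. {x. b i x \<ge> 0})"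
    by (auto simp: triangle_def)
  also have "closed \<dots>"
    using b_cont by (intro closed_INT ballI closed_Collect_le continuous_on_const) auto
  finally show ?thesis .
qed

lemma triangle_q: "i < 3 \<Longrightarrow> q i \<in> triangle"
  by (auto simp: triangle_def b_q)

lemma triangle_F: "x \<in> triangle \<Longrightarrow> i < 3 \<Longrightarrow> F q i x \<in> triangle"
  by (auto simp: triangle_def b_F')

lemma triangle_corner:
  assumes "x \<in> triangle" "i < 3" "b i x \<ge> 1"
  shows "x = q i"
proof (rule b_inj)
  fix j :: nat assume "j < 3"
  have "b 0 x \<ge> 0" "b 1 x \<ge> 0" "b 2 x \<ge> 0"
    using assms(1) by (auto simp: triangle_def)
  with assms(3) b_sum[of x] less_3_cases[OF assms(2)] less_3_cases[OF \<open>j < 3\<close>]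
  show "b j x = b j (q i)"
    by (elim disjE) (simp_all add: sum_lessThan_3 b_q)
qed

text \<open>Hence two different cells of level 1 meet only at their common corner: a point of the
  cell of \<open>i\<close> that also lies in the cell of \<open>j\<close> has its
  \<open>j\<close>-th coordinate at least 1/2.\<close>

lemma triangle_half:
  assumes "x \<in> triangle" "i < 3" "j < 3" "i \<noteq> j" "b j (F q i x) \<ge> 1/2"
  shows "x = q j"
  using assms by (intro triangle_corner) (auto simp: b_F')

text \<open>This is the union of all vertex sets V_m. Generating it without levels lets one rule
  induction cover all of them.\<close>

inductive_set Vs :: "(real^2) set" where
  Vs_q: "i < 3 \<Longrightarrow> q i \<in> Vs"
| Vs_F: "x \<in> Vs \<Longrightarrow> i < 3 \<Longrightarrow> F q i x \<in> Vs"

text \<open>This is the gasket, but only its self-similarity matters: \<^term>\<open>SG q\<close> never has to be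
  identified with it.\<close>

definition K :: "(real^2) set" where "K = closure Vs"

lemma Vs_subset_triangle: "Vs \<subseteq> triangle"
proof
  fix x assume "x \<in> Vs" then show "x \<in> triangle"
    by induction (auto simp: triangle_q triangle_F)
qed

lemma K_subset_triangle: "K \<subseteq> triangle"
  unfolding K_def by (intro closure_minimal Vs_subset_triangle closed_triangle)

lemma K_q: "i < 3 \<Longrightarrow> q i \<in> K"
  using Vs_q closure_subset by (auto simp: K_def)

lemma continuous_F: "continuous_on S (F q i)"
  unfolding F_def by (intro continuous_intros)

lemma K_F: "x \<in> K \<Longrightarrow> i < 3 \<Longrightarrow> F q i x \<in> K"
proof -
  assume "x \<in> K" "i < 3"
  moreover from \<open>i < 3\<close> have "F q i ` Vs \<subseteq> closure Vs"
    using Vs_F closure_subset by blast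
  then have "F q i ` closure Vs \<subseteq> closure Vs"
    by (rule image_closure_subset[OF continuous_F closed_closure])
  ultimately show "F q i x \<in> K" by (auto simp: K_def)
qed

lemma closed_K: "closed K" by (simp add: K_def)

lemma F_eq_iff: "F q i y = x \<longleftrightarrow> y = 2 *\<^sub>R x - q i"
proof -
  have "F q i y = x \<longleftrightarrow> 2 *\<^sub>R F q i y = 2 *\<^sub>R x" by simp
  also have "2 *\<^sub>R F q i y = y + q i" by (simp add: F_def)
  finally show ?thesis by (simp add: eq_diff_eq)
qed

text \<open>As a preimage under the inverse dilation, a cell is closed by continuity.\<close>

lemma F_image: "F q i ` S = (\<lambda>x. 2 *\<^sub>R x - q i) -` S"
  using F_eq_iff by (auto simp: image_iff) (metis F_eq_iff)+

lemma closed_F_image: "closed S \<Longrightarrow> closed (F q i ` S)"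
  unfolding F_image by (intro closed_vimage continuous_intros)

lemma K_eq: "K = (\<Union>i<3. F q i ` K)"
proof
  have "Vs \<subseteq> (\<Union>i<3. F q i ` K)"
  proof
    fix x assume "x \<in> Vs" then show "x \<in> (\<Union>i<3. F q i ` K)"
    proof cases
      case (Vs_q i)
      with K_q F_q show ?thesis by (metis UN_I imageI lessThan_iff)
    next
      case (Vs_F y i)
      then have "y \<in> K" using closure_subset by (auto simp: K_def)
      with Vs_F show ?thesis by auto
    qed
  qed
  moreover have "closed (\<Union>i<3. F q i ` K)"
    by (intro closed_UN ballI closed_F_image closed_K) auto
  ultimately show "K \<subseteq> (\<Union>i<3. F q i ` K)"
    unfolding K_def by (rule closure_minimal)
qed (auto simp: K_F)

lemma K_cases:
  assumes "x \<in> K"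
  obtains i y where "i < 3" "y \<in> K" "x = F q i y"
  using assms K_eq by blast

text \<open>The piece \<open>u i\<close> is transported to the cell of \<open>i\<close> by the
  inverse of \<open>F q i\<close>. A coordinate of at least 1/2 marks the cell; a common corner of
  two cells goes to the smaller index, which is harmless for \<open>compatible\<close>
  pieces.\<close>

definition paste :: "(nat \<Rightarrow> real^2 \<Rightarrow> real) \<Rightarrow> real^2 \<Rightarrow> real" where
  "paste u x = (let i = if b 0 x \<ge> 1/2 then 0 else if b 1 x \<ge> 1/2 then 1 else 2
     in u i (2 *\<^sub>R x - q i))"

definition compatible :: "(nat \<Rightarrow> real^2 \<Rightarrow> real) \<Rightarrow> bool" where
  "compatible u \<longleftrightarrow> (\<forall>i<3. \<forall>j<3. u i (q j) = u j (q i))"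

lemma paste_F:
  assumes "compatible u" "i < 3" "x \<in> K"
  shows "paste u (F q i x) = u i x"
proof -
  have x: "x \<in> triangle" using assms K_subset_triangle by auto
  \<comment> \<open>Whichever cell \<open>paste\<close> selects, the value is right: a wrong index
    \<open>j\<close> is possible only at the common corner, where compatibility applies.\<close>
  have *: "u j (2 *\<^sub>R F q i x - q j) = u i x" if "j < 3" "b j (F q i x) \<ge> 1/2" for j
  proof (cases "i = j")
    case True then show ?thesis by (simp add: F_def)
  next
    case False
    with triangle_half x assms(2) that have "x = q j" by blast
    then have "2 *\<^sub>R F q i x - q j = q i" by (simp add: F_def)
    with \<open>x = q j\<close> assms that show ?thesis by (simp add: compatible_def)
  qed
  have "b i (F q i x) \<ge> 1/2" using x assms by (auto simp: b_F' triangle_def)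
  then have "b 2 (F q i x) \<ge> 1/2" if "\<not> b 0 (F q i x) \<ge> 1/2" "\<not> b 1 (F q i x) \<ge> 1/2"
    using less_3_cases[OF assms(2)] that by auto
  then show ?thesis
    using *[of 0] *[of 1] *[of 2] by (simp add: paste_def Let_def del: One_nat_def)
qed

lemma continuous_on_paste:
  assumes "compatible u" "\<And>i. i < 3 \<Longrightarrow> continuous_on K (u i)"
  shows "continuous_on K (paste u)"
proof -
  have "continuous_on (F q i ` K) (paste u)" if "i < 3" for i
  proof (rule continuous_on_eq)
    show "continuous_on (F q i ` K) (\<lambda>x. u i (2 *\<^sub>R x - q i))"
      using that by (intro continuous_on_compose2[OF assms(2)] continuous_intros) (auto simp: F_def)
    show "u i (2 *\<^sub>R x - q i) = paste u x" if x: "x \<in> F q i ` K" for x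
    proof -
      obtain y where "y \<in> K" "x = F q i y" using x by blast
      with paste_F[OF assms(1) \<open>i < 3\<close>] show ?thesis by (simp add: F_def)
    qed
  qed
  then have "continuous_on (F q 0 ` K \<union> F q 1 ` K \<union> F q 2 ` K) (paste u)"
    by (intro continuous_on_closed_Un closed_Un closed_F_image closed_K) auto
  also have "F q 0 ` K \<union> F q 1 ` K \<union> F q 2 ` K = K"
    using K_eq by (auto simp: lessThan_3)
  finally show ?thesis .
qed

section \<open>Harmonic functions and harmonic splines\<close>

text \<open>The \<open>1/5\<close>-\<open>2/5\<close> rule on the cell \<open>F\<^sub>i\<close>: the sum makes the weights \<open>2/5\<close> at \<open>i\<close> and \<open>j\<close> and \<open>1/5\<close>
  at the third corner.\<close>

definition A :: "nat \<Rightarrow> (nat \<Rightarrow> real) \<Rightarrow> nat \<Rightarrow> real" where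
  "A i v j = (if i = j then v i else (v i + v j + (\<Sum>k<3. v k)) / 5)"

lemma A_commute: "A i v j = A j v i"
  by (simp add: A_def add.commute)

text \<open>The \<open>m\<close>-th approximation to the harmonic function with corner values
  \<open>v\<close>: harmonic values at the vertices of level \<open>m\<close>, affine interpolation
  inside the cells.\<close>

primrec H :: "nat \<Rightarrow> (nat \<Rightarrow> real) \<Rightarrow> real^2 \<Rightarrow> real" where
  "H 0 v x = (\<Sum>i<3. v i * b i x)"
| "H (Suc m) v x = paste (\<lambda>i. H m (A i v)) x"

text \<open>The corner values appear as a hypothesis because \<open>H_q\<close> is itself proved
  through \<open>paste_F\<close>, which asks for compatibility; the induction there supplies them
  one level down.\<close>

lemma compatible_H_aux: "(\<And>w k. k < 3 \<Longrightarrow> H m w (q k) = w k) \<Longrightarrow> compatible (\<lambda>i. H m (A i v))"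
  by (auto simp: compatible_def A_commute)

lemma H_q: "i < 3 \<Longrightarrow> H m v (q i) = v i"
proof (induction m arbitrary: i v)
  case 0 then show ?case by (simp add: b_q if_distrib sum.delta of_bool_def cong: if_cong)
next
  case (Suc m)
  have "paste (\<lambda>i. H m (A i v)) (F q i (q i)) = H m (A i v) (q i)"
    using Suc by (intro paste_F compatible_H_aux K_q) auto
  with Suc show ?case by (simp add: A_def)
qed

lemma compatible_H: "compatible (\<lambda>i. H m (A i v))"
  by (intro compatible_H_aux H_q)

lemma continuous_H: "continuous_on K (H m v)"
proof (induction m arbitrary: v)
  case 0
  have "continuous_on K (b i)" for i using b_cont continuous_on_subset by blast
  then have "continuous_on K (\<lambda>x. \<Sum>i<3. v i * b i x)" by (intro continuous_intros)
  then show ?case by simp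
next
  case (Suc m)
  have "continuous_on K (paste (\<lambda>i. H m (A i v)))"
    using Suc by (intro continuous_on_paste compatible_H) auto
  then show ?case by (simp add: paste_def[abs_def] cong: continuous_on_cong)
qed

lemma H_Suc_F: "i < 3 \<Longrightarrow> x \<in> K \<Longrightarrow> H (Suc m) v (F q i x) = H m (A i v) x"
  by (simp add: paste_F[OF compatible_H])

lemma H_0_bound:
  assumes "x \<in> K" "\<And>i. i < 3 \<Longrightarrow> \<bar>v i - a\<bar> \<le> c"
  shows "\<bar>H 0 v x - a\<bar> \<le> c"
proof -
  have b: "b i x \<ge> 0" if "i < 3" for i
    using assms(1) K_subset_triangle that by (auto simp: triangle_def)
  have "H 0 v x - a = (\<Sum>i<3. v i * b i x) - a * (\<Sum>i<3. b i x)" by (simp add: b_sum)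
  also have "\<dots> = (\<Sum>i<3. (v i - a) * b i x)"
    by (simp add: sum_distrib_left left_diff_distrib sum_subtractf)
  also have "\<bar>\<dots>\<bar> \<le> (\<Sum>i<3. c * b i x)"
    by (rule order_trans[OF sum_abs], rule sum_mono) (auto simp: abs_mult b assms intro!: mult_right_mono)
  also have "\<dots> = c" by (simp add: b_sum flip: sum_distrib_left)
  finally show ?thesis .
qed

text \<open>Differences of the new values are a third of the way inside the old ones: two midpoint
  values differ by 1/5 of an old difference, a corner and a midpoint value by a combination of old
  differences with weights 2/5 and 1/5.\<close>

lemma A_oscillation:
  assumes "\<And>j k. j < 3 \<Longrightarrow> k < 3 \<Longrightarrow> \<bar>v j - v k\<bar> \<le> c" "i < 3" "j < 3" "k < 3"
  shows "\<bar>A i v j - A i v k\<bar> \<le> 3/5 * c"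
proof -
  have "\<bar>v 0 - v 1\<bar> \<le> c" "\<bar>v 0 - v 2\<bar> \<le> c" "\<bar>v 1 - v 2\<bar> \<le> c"
    using assms(1) by auto
  then show ?thesis
    using less_3_cases[OF assms(2)] less_3_cases[OF assms(3)] less_3_cases[OF assms(4)]
    by (elim disjE) (simp_all add: A_def sum_lessThan_3 abs_le_iff field_simps)
qed

text \<open>Passing to a cell shrinks the oscillation by 3/5, so induction reduces everything to the
  first step, where both functions stay within \<open>c\<close> of \<open>v 0\<close>.\<close>

lemma H_step:
  assumes "\<And>j k. j < 3 \<Longrightarrow> k < 3 \<Longrightarrow> \<bar>v j - v k\<bar> \<le> c" "x \<in> K"
  shows "\<bar>H (Suc m) v x - H m v x\<bar> \<le> (3/5)^m * (2 * c)"
  using assms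
proof (induction m arbitrary: v c x)
  case 0
  obtain i y where y: "i < 3" "y \<in> K" "x = F q i y" using 0(2) by (rule K_cases)
  have "\<bar>H 0 (A i v) y - v 0\<bar> \<le> c"
  proof (rule H_0_bound[OF y(2)])
    fix j :: nat assume "j < 3"
    have "\<bar>v 0 - v 1\<bar> \<le> c" "\<bar>v 0 - v 2\<bar> \<le> c" "\<bar>v 1 - v 2\<bar> \<le> c" using 0(1) by auto
    then show "\<bar>A i v j - v 0\<bar> \<le> c"
      using less_3_cases[OF y(1)] less_3_cases[OF \<open>j < 3\<close>]
      by (elim disjE) (simp_all add: A_def sum_lessThan_3 abs_le_iff field_simps)
  qed
  moreover have "\<bar>H 0 v x - v 0\<bar> \<le> c" using 0 by (intro H_0_bound) auto
  moreover have "H (Suc 0) v x = H 0 (A i v) y" using H_Suc_F y by blast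
  ultimately show ?case by (simp only: power_0)
next
  case (Suc m)
  obtain i y where y: "i < 3" "y \<in> K" "x = F q i y" using Suc.prems(2) by (rule K_cases)
  have "\<bar>H (Suc m) (A i v) y - H m (A i v) y\<bar> \<le> (3/5)^m * (2 * (3/5 * c))"
    using Suc.prems(1) y by (intro Suc.IH A_oscillation) auto
  with y show ?case by (simp only: H_Suc_F) simp
qed

definition h :: "(nat \<Rightarrow> real) \<Rightarrow> real^2 \<Rightarrow> real" where
  "h v x = lim (\<lambda>m. H m v x)"

text \<open>The telescoping series of increments is dominated by a geometric series. Uniformity is
  what makes the limit continuous.\<close>

lemma uniform_limit_H: "uniform_limit K (\<lambda>m. H m v) (h v) sequentially"
proof -
  \<comment> \<open>A crude bound on the oscillation of \<open>v\<close>; any finite one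
    works.\<close>
  define c where "c = (\<Sum>j<3. \<Sum>k<3. \<bar>v j - v k\<bar>)"
  have c: "\<bar>v j - v k\<bar> \<le> c" if "j < 3" "k < 3" for j k
    using less_3_cases[OF that(1)] less_3_cases[OF that(2)]
    by (elim disjE) (simp_all add: c_def sum_lessThan_3)
  define f where "f m x = H (Suc m) v x - H m v x" for m x
  have "uniform_limit K (\<lambda>n x. \<Sum>m<n. f m x) (\<lambda>x. suminf (\<lambda>m. f m x)) sequentially"
  proof (rule Weierstrass_m_test)
    show "norm (f n x) \<le> (3/5)^n * (2 * c)" if "x \<in> K" for n x
      using H_step[of v c x n] c that by (simp only: f_def real_norm_def)
    show "summable (\<lambda>n. (3/5)^n * (2 * c))" by (intro summable_mult2 summable_geometric) auto
  qed
  moreover have "(\<Sum>m<n. f m x) = H n v x - H 0 v x" for n x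
    unfolding f_def by (rule sum_lessThan_telescope)
  ultimately have "uniform_limit K (\<lambda>n x. H n v x - H 0 v x) (\<lambda>x. suminf (\<lambda>m. f m x)) sequentially"
    by (simp only:)
  then have "uniform_limit K (\<lambda>n x. H n v x - H 0 v x + H 0 v x) (\<lambda>x. suminf (\<lambda>m. f m x) + H 0 v x) sequentially"
    by (intro uniform_limit_add uniform_limit_const)
  then have *: "uniform_limit K (\<lambda>n. H n v) (\<lambda>x. suminf (\<lambda>m. f m x) + H 0 v x) sequentially"
    by (simp only: diff_add_cancel)
  moreover have "h v x = suminf (\<lambda>m. f m x) + H 0 v x" if "x \<in> K" for x
    unfolding h_def using tendsto_uniform_limitI[OF * that] by (rule limI)
  ultimately show ?thesis
    by (metis (no_types, lifting) uniform_limit_cong')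
qed

lemma H_tendsto: "x \<in> K \<Longrightarrow> (\<lambda>m. H m v x) \<longlonglongrightarrow> h v x"
  using uniform_limit_H by (rule tendsto_uniform_limitI)

lemma continuous_h: "continuous_on K (h v)"
  by (rule uniform_limit_theorem[OF _ uniform_limit_H]) (auto simp: continuous_H simp del: H.simps)

text \<open>The recursion of \<open>H\<close> passes to the limit: restricted to a cell,
  \<open>h v\<close> is again such a function, with corner values given by the 1/5-2/5 rule.\<close>

lemma h_F:
  assumes "i < 3" "x \<in> K" shows "h v (F q i x) = h (A i v) x"
proof -
  have "(\<lambda>m. H (Suc m) v (F q i x)) \<longlonglongrightarrow> h v (F q i x)"
    using H_tendsto[OF K_F] assms by (intro LIMSEQ_Suc) blast
  with assms have "(\<lambda>m. H m (A i v) x) \<longlonglongrightarrow> h v (F q i x)" by (simp only: H_Suc_F)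
  with H_tendsto[OF assms(2)] show ?thesis using LIMSEQ_unique by blast
qed

lemma h_q: "i < 3 \<Longrightarrow> h v (q i) = v i"
  using H_tendsto[OF K_q, of i v] by (simp only: H_q) (simp add: LIMSEQ_const_iff)

text \<open>The function agreeing with \<open>g\<close> on \<open>V\<^sub>m\<close> and harmonic on the cells of level \<open>m\<close>.\<close>

primrec spline :: "nat \<Rightarrow> (real^2 \<Rightarrow> real) \<Rightarrow> real^2 \<Rightarrow> real" where
  "spline 0 g = h (\<lambda>i. g (q i))"
| "spline (Suc m) g = paste (\<lambda>i. spline m (g \<circ> F q i))"

lemma compatible_spline_aux:
  "(\<And>g k. k < 3 \<Longrightarrow> spline m g (q k) = g (q k)) \<Longrightarrow> compatible (\<lambda>i. spline m (g \<circ> F q i))"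
  by (auto simp: compatible_def F_q_commute)

lemma spline_q: "i < 3 \<Longrightarrow> spline m g (q i) = g (q i)"
proof (induction m arbitrary: g i)
  case 0 then show ?case by (simp add: h_q)
next
  case (Suc m)
  have "paste (\<lambda>i. spline m (g \<circ> F q i)) (F q i (q i)) = spline m (g \<circ> F q i) (q i)"
    using Suc by (intro paste_F compatible_spline_aux K_q) auto
  with Suc show ?case by simp
qed

lemma compatible_spline: "compatible (\<lambda>i. spline m (g \<circ> F q i))"
  by (intro compatible_spline_aux spline_q)

lemma continuous_spline: "continuous_on K (spline m g)"
  by (induction m arbitrary: g) (auto simp: continuous_h intro!: continuous_on_paste compatible_spline)

lemma spline_F: "i < 3 \<Longrightarrow> x \<in> K \<Longrightarrow> spline (Suc m) g (F q i x) = spline m (g \<circ> F q i) x"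
  by (simp add: paste_F[OF compatible_spline])

end

section \<open>Graph energies, their monotonicity, and the energy of splines\<close>

text \<open>Here \<open>a\<close>, \<open>b\<close>, \<open>c\<close> are corner values and
  \<open>x\<close>, \<open>y\<close>, \<open>z\<close> midpoint values. Completing squares about the
  1/5-2/5 values leaves a nonnegative remainder that vanishes there, which yields both monotonicity
  and its equality case.\<close>

lemma harmonic_extension_identity:
  fixes a b c x y z :: real
  shows "5/3 * (((a - x)\<^sup>2 + (a - y)\<^sup>2 + (x - y)\<^sup>2) + ((x - b)\<^sup>2 + (x - z)\<^sup>2 + (b - z)\<^sup>2)
      + ((y - z)\<^sup>2 + (y - c)\<^sup>2 + (z - c)\<^sup>2))
    = (a - b)\<^sup>2 + (a - c)\<^sup>2 + (b - c)\<^sup>2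
      + 5/3 * (2 * (x - (2*a + 2*b + c)/5)\<^sup>2 + 2 * (y - (2*a + b + 2*c)/5)\<^sup>2 + 2 * (z - (a + 2*b + 2*c)/5)\<^sup>2
        + ((x - (2*a + 2*b + c)/5) - (y - (2*a + b + 2*c)/5))\<^sup>2 + ((x - (2*a + 2*b + c)/5) - (z - (a + 2*b + 2*c)/5))\<^sup>2
        + ((y - (2*a + b + 2*c)/5) - (z - (a + 2*b + 2*c)/5))\<^sup>2)"
  by (simp add: power2_eq_square algebra_simps add_divide_distrib diff_divide_distrib)

context barycentric
begin

definition edges :: "nat \<Rightarrow> ((real^2) \<times> (real^2)) set" where
  "edges m = {(x, y). adj q m x y}"

lemma edges_0: "edges 0 = {(q 0, q 1), (q 0, q 2), (q 1, q 0), (q 1, q 2), (q 2, q 0), (q 2, q 1)}"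
  using q_inject by (auto simp: edges_def adj_def F_word_def V0_def)

lemma edges_Suc: "edges (Suc m) = (\<Union>i<3. map_prod (F q i) (F q i) ` edges m)"
proof (intro equalityI subsetI)
  fix e assume "e \<in> edges (Suc m)"
  then obtain x y w where e: "e = (x, y)" "x \<noteq> y" and w: "length w = Suc m" "set w \<subseteq> {..<3}"
    and xy: "x \<in> F_word q w ` V0 q" "y \<in> F_word q w ` V0 q"
    by (auto simp: edges_def adj_def)
  obtain i v where v: "w = i # v" "length v = m" using w(1) by (auto simp: length_Suc_conv)
  then obtain x' y' where xy': "x = F q i x'" "y = F q i y'" "x' \<in> F_word q v ` V0 q" "y' \<in> F_word q v ` V0 q"
    using xy by (auto simp: F_word_def)
  then have "(x', y') \<in> edges m"
    using e v w by (auto simp: edges_def adj_def)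
  with e xy' v w show "e \<in> (\<Union>i<3. map_prod (F q i) (F q i) ` edges m)" by auto
next
  fix e assume "e \<in> (\<Union>i<3. map_prod (F q i) (F q i) ` edges m)"
  then obtain i x y w where *: "i < 3" "e = (F q i x, F q i y)" "x \<noteq> y" "length w = m" "set w \<subseteq> {..<3}"
    "x \<in> F_word q w ` V0 q" "y \<in> F_word q w ` V0 q"
    by (auto simp: edges_def adj_def)
  then have "F q i x \<noteq> F q i y" using inj_F by (auto dest: injD)
  moreover have "F q i x \<in> F_word q (i # w) ` V0 q" "F q i y \<in> F_word q (i # w) ` V0 q"
    using * by (auto simp: F_word_def)
  ultimately show "e \<in> edges (Suc m)"
    using * by (auto simp: edges_def adj_def intro!: exI[of _ "i # w"])
qed

lemma finite_edges: "finite (edges m)"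
  by (induction m) (auto simp: edges_0 edges_Suc)

lemma edges_subset_Vs: "edges m \<subseteq> Vs \<times> Vs"
  by (induction m) (auto simp: edges_0 edges_Suc intro: Vs.intros)

lemma edges_neq: "(x, y) \<in> edges m \<Longrightarrow> x \<noteq> y"
  by (auto simp: edges_def adj_def)

text \<open>Distinct cells share at most one point, hence no edge.\<close>

lemma disjoint_edges:
  assumes "i < 3" "j < 3" "i \<noteq> j"
  shows "map_prod (F q i) (F q i) ` edges m \<inter> map_prod (F q j) (F q j) ` edges m = {}"
proof (rule ccontr)
  assume "\<not> ?thesis"
  then obtain x y x' y' where *: "(x, y) \<in> edges m" "(x', y') \<in> edges m"
    "F q i x = F q j x'" "F q i y = F q j y'"
    by auto
  then have "x \<in> triangle" "y \<in> triangle" "x' \<in> triangle" "y' \<in> triangle"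
    using edges_subset_Vs Vs_subset_triangle by blast+
  then have "b j x' \<ge> 0" "b j y' \<ge> 0" "x \<in> triangle" "y \<in> triangle"
    using assms by (auto simp: triangle_def)
  moreover have "b j (F q i x) = (b j x' + 1) / 2" "b j (F q i y) = (b j y' + 1) / 2"
    unfolding * using assms by (simp_all add: b_F')
  ultimately have "x = q j" "y = q j" using assms by (auto intro!: triangle_half)
  with * edges_neq show False by blast
qed

lemma graph_energy_edges:
  "graph_energy q m u = (5/3)^m * (1/2 * (\<Sum>(x,y)\<in>edges m. (u x - u y)\<^sup>2))"
  by (simp add: graph_energy_def edges_def)

lemma graph_energy_0: "graph_energy q 0 u = (u (q 0) - u (q 1))\<^sup>2 + (u (q 0) - u (q 2))\<^sup>2 + (u (q 1) - u (q 2))\<^sup>2"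
  using q_inject by (simp add: graph_energy_edges edges_0 power2_commute)

text \<open>Self-similarity: the edges of level \<open>Suc m\<close> split disjointly into three
  copies of those of level \<open>m\<close>. Inductions on the level rest on it.\<close>

lemma graph_energy_Suc: "graph_energy q (Suc m) u = 5/3 * (\<Sum>i<3. graph_energy q m (u \<circ> F q i))"
proof -
  have inj: "inj_on (map_prod (F q i) (F q i)) (edges m)" for i
    using inj_F[of i] by (auto intro!: inj_onI simp: inj_eq)
  have "(\<Sum>(x,y)\<in>edges (Suc m). (u x - u y)\<^sup>2)
      = (\<Sum>i<3. \<Sum>(x,y)\<in>map_prod (F q i) (F q i) ` edges m. (u x - u y)\<^sup>2)"
    unfolding edges_Suc using disjoint_edges finite_edges by (intro sum.UNION_disjoint) auto
  also have "\<dots> = (\<Sum>i<3. \<Sum>(x,y)\<in>edges m. ((u \<circ> F q i) x - (u \<circ> F q i) y)\<^sup>2)"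
    by (rule sum.cong[OF refl], subst sum.reindex[OF inj]) (simp add: case_prod_unfold)
  finally show ?thesis
    by (simp add: graph_energy_edges sum_distrib_left mult_ac)
qed

lemma graph_energy_cong: "(\<And>x. x \<in> Vs \<Longrightarrow> u x = v x) \<Longrightarrow> graph_energy q m u = graph_energy q m v"
  using edges_subset_Vs[of m] unfolding graph_energy_edges by (intro arg_cong2[where f = "(*)"] refl sum.cong) auto

lemma graph_energy_1:
  "graph_energy q (Suc 0) u = 5/3 * (((u (q 0) - u (F q 0 (q 1)))\<^sup>2 + (u (q 0) - u (F q 0 (q 2)))\<^sup>2 + (u (F q 0 (q 1)) - u (F q 0 (q 2)))\<^sup>2)
    + ((u (F q 0 (q 1)) - u (q 1))\<^sup>2 + (u (F q 0 (q 1)) - u (F q 1 (q 2)))\<^sup>2 + (u (q 1) - u (F q 1 (q 2)))\<^sup>2)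
    + ((u (F q 0 (q 2)) - u (F q 1 (q 2)))\<^sup>2 + (u (F q 0 (q 2)) - u (q 2))\<^sup>2 + (u (F q 1 (q 2)) - u (q 2))\<^sup>2))"
  by (simp add: graph_energy_Suc graph_energy_0 sum_lessThan_3 F_q_commute[of 1 0] F_q_commute[of 2 0] F_q_commute[of 2 1]
    del: One_nat_def)

lemma graph_energy_0_le_1: "graph_energy q 0 u \<le> graph_energy q (Suc 0) u"
  unfolding graph_energy_1 harmonic_extension_identity graph_energy_0 by simp

lemma graph_energy_le_Suc: "graph_energy q m u \<le> graph_energy q (Suc m) u"
proof (induction m arbitrary: u)
  case (Suc m)
  then show ?case
    unfolding graph_energy_Suc[of m] graph_energy_Suc[of "Suc m"]
    by (intro mult_left_mono sum_mono) auto
qed (rule graph_energy_0_le_1)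

text \<open>Monotonicity turns the limit into a supremum, which exists in \<open>ereal\<close> for
  infinite energy too.\<close>

lemma energy_eq_SUP: "energy q u = (SUP m. ereal (graph_energy q m u))"
  unfolding energy_def
  by (intro limI LIMSEQ_SUP incseq_SucI) (simp add: graph_energy_le_Suc)

lemma graph_energy_le_energy: "ereal (graph_energy q m u) \<le> energy q u"
  unfolding energy_eq_SUP by (rule SUP_upper) simp

lemma graph_energy_h: "graph_energy q m (h v) = graph_energy q 0 (h v)"
proof (induction m arbitrary: v)
  case (Suc m)
  have F: "graph_energy q k (h v \<circ> F q i) = graph_energy q k (h (A i v))" if "i < 3" for i k
    using that closure_subset[of Vs] by (intro graph_energy_cong) (auto simp: K_def h_F)
  have "graph_energy q (Suc m) (h v) = 5/3 * (\<Sum>i<3. graph_energy q m (h (A i v)))"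
    unfolding graph_energy_Suc by (simp add: F)
  \<comment> \<open>The induction hypothesis brings each cell down to level 0. The three cells then
    reassemble to level 1, where the harmonic identity has zero remainder.\<close>
  also have "\<dots> = 5/3 * (\<Sum>i<3. graph_energy q 0 (h (A i v)))"
    unfolding Suc.IH ..
  also have "\<dots> = graph_energy q (Suc 0) (h v)"
    unfolding graph_energy_Suc by (simp add: F)
  also have "\<dots> = graph_energy q 0 (h v)"
    unfolding graph_energy_1 harmonic_extension_identity graph_energy_0
    using h_F[of 0 "q 1" v] h_F[of 0 "q 2" v] h_F[of 1 "q 2" v]
    by (simp add: K_q h_q A_def sum_lessThan_3 algebra_simps add_divide_distrib del: One_nat_def)
  finally show ?case .
qed simp

text \<open>Inside the cells of level \<open>m\<close> the spline is harmonic, so refinement beyond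
  that level adds no energy.\<close>

lemma graph_energy_spline: "graph_energy q (k + m) (spline m g) = graph_energy q m g"
proof (induction m arbitrary: g)
  case 0
  have "graph_energy q k (h (\<lambda>i. g (q i))) = graph_energy q 0 (h (\<lambda>i. g (q i)))"
    by (rule graph_energy_h)
  then show ?case by (simp add: graph_energy_0 h_q)
next
  case (Suc m)
  have "graph_energy q (k + m) (spline (Suc m) g \<circ> F q i) = graph_energy q m (g \<circ> F q i)" if "i < 3" for i
  proof -
    have "graph_energy q (k + m) (spline (Suc m) g \<circ> F q i) = graph_energy q (k + m) (spline m (g \<circ> F q i))"
      using that closure_subset[of Vs] by (intro graph_energy_cong) (auto simp: K_def spline_F simp del: spline.simps)
    also have "\<dots> = graph_energy q m (g \<circ> F q i)" by (rule Suc)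
    finally show ?thesis .
  qed
  then show ?case
    unfolding add_Suc_right graph_energy_Suc by (intro arg_cong2[where f = "(*)"] refl sum.cong) auto
qed

lemma energy_spline: "energy q (spline m g) = ereal (graph_energy q m g)"
proof (rule antisym)
  show "energy q (spline m g) \<le> ereal (graph_energy q m g)"
    unfolding energy_eq_SUP
  proof (rule SUP_least)
    fix k
    have "graph_energy q k (spline m g) \<le> graph_energy q (k + m) (spline m g)"
      by (rule lift_Suc_mono_le[of "\<lambda>k. graph_energy q k _"]) (auto simp: graph_energy_le_Suc)
    then show "ereal (graph_energy q k (spline m g)) \<le> ereal (graph_energy q m g)"
      by (simp add: graph_energy_spline)
  qed
  show "ereal (graph_energy q m g) \<le> energy q (spline m g)"
    using graph_energy_le_energy[of m "spline m g"] graph_energy_spline[of 0 m g] by simp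
qed

lemma energy_cong: "(\<And>x. x \<in> Vs \<Longrightarrow> u x = v x) \<Longrightarrow> energy q u = energy q v"
  unfolding energy_def using graph_energy_cong[of u v] by simp

text \<open>Extending from \<open>K\<close> to the plane gives continuity on \<open>SG q\<close> whatever that set is.\<close>

lemma ex_dom_energy_spline:
  obtains u where "u \<in> dom_energy q" "energy q u = ereal (graph_energy q m g)"
    "\<And>x. x \<in> K \<Longrightarrow> u x = spline m g x"
proof -
  obtain u where u: "continuous_on UNIV u" "\<And>x. x \<in> K \<Longrightarrow> u x = spline m g x"
    using Tietze_unbounded[OF continuous_spline[of m g], of UNIV] closed_K by (auto simp: K_def)
  have "energy q u = energy q (spline m g)"
    using u(2) closure_subset[of Vs] by (intro energy_cong) (auto simp: K_def)
  then have "energy q u = ereal (graph_energy q m g)" by (simp add: energy_spline)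
  with u show ?thesis
    by (intro that[of u]) (auto simp: dom_energy_def intro: continuous_on_subset)
qed

lemma spline_2:
  assumes "i < 3" "j < 3" "k < 3"
  shows "spline 2 g (F q i (F q j (q k))) = g (F q i (F q j (q k)))"
proof -
  have "spline (Suc (Suc 0)) g (F q i (F q j (q k))) = spline (Suc 0) (g \<circ> F q i) (F q j (q k))"
    using assms by (intro spline_F K_F K_q)
  also have "\<dots> = g (F q i (F q j (q k)))"
    using assms by (simp add: spline_F K_q h_q del: spline.simps(2))
  finally show ?thesis by (simp add: numeral_2_eq_2)
qed

end

section \<open>Uniqueness of the conductances\<close>

lemma is_conductances_unique:
  assumes "is_conductances q A c" "is_conductances q A c'" "finite A"
  shows "c = c'"
proof -
  define Q where "Q c f = (1/2) * (\<Sum>x\<in>A. \<Sum>y\<in>A. c x y * (f x - f y)\<^sup>2)"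
    for c :: "real^2 \<Rightarrow> real^2 \<Rightarrow> real" and f :: "real^2 \<Rightarrow> real"
  \<comment> \<open>Both forms give the least energy for the data \<open>f\<close>; they see only
    values on \<open>A\<close>, where the minimizers agree with \<open>f\<close>.\<close>
  have Q: "Q c f = Q c' f" for f
  proof -
    obtain u where u: "least_energy_ext q A f u" "energy q u = ereal (Q c u)"
      using assms(1) unfolding is_conductances_def Q_def by blast
    obtain v where v: "least_energy_ext q A f v" "energy q v = ereal (Q c' v)"
      using assms(2) unfolding is_conductances_def Q_def by blast
    have "energy q u = energy q v"
      using u(1) v(1) by (intro antisym) (auto simp: least_energy_ext_def)
    moreover have "Q c u = Q c f" "Q c' v = Q c' f"
      using u(1) v(1) by (auto simp: Q_def least_energy_ext_def)
    ultimately show ?thesis using u v by simp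
  qed
  \<comment> \<open>Polarization with indicator functions: edges from \<open>s\<close> or
    \<open>t\<close> to other points cancel, while the edge between \<open>s\<close> and
    \<open>t\<close> counts once in each of the first two terms and not in the third.\<close>
  have polar: "Q d (\<lambda>x. of_bool (x = s)) + Q d (\<lambda>x. of_bool (x = t)) - Q d (\<lambda>x. of_bool (x = s \<or> x = t))
      = 2 * d s t" if d: "is_conductances q A d" and st: "s \<in> A" "t \<in> A" "s \<noteq> t" for d s t
  proof -
    have sym: "d x y = d y x" for x y using d by (simp add: is_conductances_def)
    have "Q d (\<lambda>x. of_bool (x = s)) + Q d (\<lambda>x. of_bool (x = t)) - Q d (\<lambda>x. of_bool (x = s \<or> x = t))
        = 1/2 * (\<Sum>x\<in>A. \<Sum>y\<in>A. d x y * ((of_bool (x = s) - of_bool (y = s))\<^sup>2 + (of_bool (x = t) - of_bool (y = t))\<^sup>2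
             - (of_bool (x = s \<or> x = t) - of_bool (y = s \<or> y = t))\<^sup>2))"
      by (simp add: Q_def sum.distrib sum_subtractf distrib_left right_diff_distrib)
    also have "\<dots> = 1/2 * (\<Sum>x\<in>A. \<Sum>y\<in>A. (if x = s then if y = t then 2 * d s t else 0 else 0)
        + (if x = t then if y = s then 2 * d s t else 0 else 0))"
      using st sym by (intro arg_cong2[where f = "(*)"] refl sum.cong) auto
    also have "\<dots> = 1/2 * ((\<Sum>x\<in>A. if x = s then \<Sum>y\<in>A. if y = t then 2 * d s t else 0 else 0)
        + (\<Sum>x\<in>A. if x = t then \<Sum>y\<in>A. if y = s then 2 * d s t else 0 else 0))"
      unfolding sum.distrib[symmetric] by (intro arg_cong2[where f = "(*)"] refl sum.cong) (auto simp: sum.distrib)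
    also have "\<dots> = 2 * d s t"
      using st assms(3) by simp
    finally show ?thesis .
  qed
  show ?thesis
  proof (intro ext)
    fix x y show "c x y = c' x y"
    proof (cases "x \<in> A \<and> y \<in> A \<and> x \<noteq> y")
      case True
      with polar[OF assms(1), of x y] polar[OF assms(2), of x y] show ?thesis by (simp add: Q)
    next
      case False
      with assms(1,2) show ?thesis unfolding is_conductances_def by simp
    qed
  qed
qed

section \<open>Elimination of vertices by completing squares\<close>

text \<open>The unscaled energy of a level-1 cell subdivided once: \<open>a\<close>,
  \<open>b\<close>, \<open>c\<close> are its corner values, and \<open>e\<close>, \<open>f\<close>,
  \<open>d\<close> the values at the midpoints of the sides ab, ac, bc. In use, \<open>a\<close>
  sits at a corner \<open>q i\<close> and \<open>d\<close> at \<open>p i\<close>.\<close>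

definition cell_energy :: "real \<Rightarrow> real \<Rightarrow> real \<Rightarrow> real \<Rightarrow> real \<Rightarrow> real \<Rightarrow> real" where
  "cell_energy a b c d e f = (a - e)\<^sup>2 + (a - f)\<^sup>2 + (e - f)\<^sup>2 + (e - b)\<^sup>2 + (e - d)\<^sup>2 + (b - d)\<^sup>2
    + (f - d)\<^sup>2 + (f - c)\<^sup>2 + (d - c)\<^sup>2"

text \<open>Minimum of \<^term>\<open>cell_energy a b c d e f\<close> over \<open>e\<close> and \<open>f\<close>.\<close>

definition reduced_cell_energy :: "real \<Rightarrow> real \<Rightarrow> real \<Rightarrow> real \<Rightarrow> real" where
  "reduced_cell_energy a b c d = 2/3 * (a - d)\<^sup>2 + 1/3 * (a - b)\<^sup>2 + 1/3 * (a - c)\<^sup>2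
    + 4/3 * (b - d)\<^sup>2 + 4/3 * (c - d)\<^sup>2 + 1/15 * (b - c)\<^sup>2"

definition conductance_form :: "real \<Rightarrow> real \<Rightarrow> real \<Rightarrow> real \<Rightarrow> real \<Rightarrow> real \<Rightarrow> real" where
  "conductance_form x0 x1 x2 y0 y1 y2 = 410/159 * ((x0 - y0)\<^sup>2 + (x1 - y1)\<^sup>2 + (x2 - y2)\<^sup>2)
    + 5/53 * ((x0 - x1)\<^sup>2 + (x0 - x2)\<^sup>2 + (x1 - x2)\<^sup>2)
    + 20/53 * ((x0 - y1)\<^sup>2 + (x0 - y2)\<^sup>2 + (x1 - y0)\<^sup>2 + (x1 - y2)\<^sup>2 + (x2 - y0)\<^sup>2 + (x2 - y1)\<^sup>2)
    + 80/53 * ((y0 - y1)\<^sup>2 + (y0 - y2)\<^sup>2 + (y1 - y2)\<^sup>2)"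

text \<open>The squares are centred at the critical point, the solution of 4e - f = a + b + d and 4f
  - e = a + c + d.\<close>

lemma cell_energy_eq:
  "cell_energy a b c d e f = reduced_cell_energy a b c d
    + (3 * (e - (5 * a + 5 * d + 4 * b + c) / 15)\<^sup>2 + 3 * (f - (5 * a + 5 * d + b + 4 * c) / 15)\<^sup>2
    + ((e - (5 * a + 5 * d + 4 * b + c) / 15) - (f - (5 * a + 5 * d + b + 4 * c) / 15))\<^sup>2)"
  by (simp add: cell_energy_def reduced_cell_energy_def power2_eq_square field_simps)

lemma cell_energy_ge: "cell_energy a b c d e f \<ge> reduced_cell_energy a b c d"
  unfolding cell_energy_eq by simp

lemma cell_energy_min:
  "cell_energy a b c d ((5 * a + 5 * d + 4 * b + c) / 15) ((5 * a + 5 * d + b + 4 * c) / 15) = reduced_cell_energy a b c d"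
  unfolding cell_energy_eq by simp

text \<open>The three cells are joined at points with values \<open>z0\<close>, \<open>z1\<close>,
  \<open>z2\<close>, and 25/9 is the scale of level 2. The centres solve 52 z0 - z1 - z2 = 5 (x1 +
  x2) + 20 (y1 + y2) and its permutations. The weight 10/3 is the total conductance 1/3 + 4/3 from a
  joining point to the kept points, taken over its two cells.\<close>

lemma reduced_cell_energy_sum:
  "25/9 * (reduced_cell_energy x0 z2 z1 y0 + reduced_cell_energy x1 z2 z0 y1 + reduced_cell_energy x2 z1 z0 y2)
  = conductance_form x0 x1 x2 y0 y1 y2
    + 25/9 * (10/3 * ((z0 - (26 * (x1 + x2) + 104 * (y1 + y2) + x0 + 4 * y0) / 265)\<^sup>2
        + (z1 - (26 * (x0 + x2) + 104 * (y0 + y2) + x1 + 4 * y1) / 265)\<^sup>2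
        + (z2 - (26 * (x0 + x1) + 104 * (y0 + y1) + x2 + 4 * y2) / 265)\<^sup>2)
      + 1/15 * (((z0 - (26 * (x1 + x2) + 104 * (y1 + y2) + x0 + 4 * y0) / 265)
          - (z1 - (26 * (x0 + x2) + 104 * (y0 + y2) + x1 + 4 * y1) / 265))\<^sup>2
        + ((z0 - (26 * (x1 + x2) + 104 * (y1 + y2) + x0 + 4 * y0) / 265)
          - (z2 - (26 * (x0 + x1) + 104 * (y0 + y1) + x2 + 4 * y2) / 265))\<^sup>2
        + ((z1 - (26 * (x0 + x2) + 104 * (y0 + y2) + x1 + 4 * y1) / 265)
          - (z2 - (26 * (x0 + x1) + 104 * (y0 + y1) + x2 + 4 * y2) / 265))\<^sup>2))"
  by (simp add: reduced_cell_energy_def conductance_form_def power2_eq_square field_simps)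

lemma reduced_cell_energy_sum_ge:
  "25/9 * (reduced_cell_energy x0 z2 z1 y0 + reduced_cell_energy x1 z2 z0 y1 + reduced_cell_energy x2 z1 z0 y2)
  \<ge> conductance_form x0 x1 x2 y0 y1 y2"
  unfolding reduced_cell_energy_sum by simp

lemma reduced_cell_energy_sum_min:
  assumes "z0 = (26 * (x1 + x2) + 104 * (y1 + y2) + x0 + 4 * y0) / 265"
    and "z1 = (26 * (x0 + x2) + 104 * (y0 + y2) + x1 + 4 * y1) / 265"
    and "z2 = (26 * (x0 + x1) + 104 * (y0 + y1) + x2 + 4 * y2) / 265"
  shows "25/9 * (reduced_cell_energy x0 z2 z1 y0 + reduced_cell_energy x1 z2 z0 y1 + reduced_cell_energy x2 z1 z0 y2)
  = conductance_form x0 x1 x2 y0 y1 y2"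
  unfolding reduced_cell_energy_sum by (simp add: assms)

section \<open>The least energy extension from the six points\<close>

context barycentric
begin

lemma graph_energy_2:
  "graph_energy q 2 u = 25/9 *
    (cell_energy (u (q 0)) (u (F q 0 (q 1))) (u (F q 0 (q 2))) (u (F q 0 (F q 2 (q 1))))
       (u (F q 0 (F q 0 (q 1)))) (u (F q 0 (F q 0 (q 2))))
   + cell_energy (u (q 1)) (u (F q 0 (q 1))) (u (F q 1 (q 2))) (u (F q 1 (F q 0 (q 2))))
       (u (F q 1 (F q 1 (q 0)))) (u (F q 1 (F q 1 (q 2))))
   + cell_energy (u (q 2)) (u (F q 0 (q 2))) (u (F q 1 (q 2))) (u (F q 2 (F q 1 (q 0))))
       (u (F q 2 (F q 2 (q 0)))) (u (F q 2 (F q 2 (q 1)))))"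
proof -
  \<comment> \<open>Each joining point has two addresses; these equations select one of
    them.\<close>
  note comm = F_q_commute[of 1 0] F_q_commute[of 2 0] F_q_commute[of 2 1]
  have "graph_energy q 2 u = graph_energy q (Suc (Suc 0)) u"
    by (simp only: numeral_2_eq_2)
  also have "\<dots> = 5/3 * (\<Sum>i<3. graph_energy q (Suc 0) (u \<circ> F q i))"
    by (rule graph_energy_Suc)
  finally show ?thesis
    by (simp only: graph_energy_1 sum_lessThan_3 o_apply comm cell_energy_def)
      (simp add: power2_commute algebra_simps del: One_nat_def)
qed

lemma graph_energy_2_ge:
  "conductance_form (u (q 0)) (u (q 1)) (u (q 2)) (u (F q 0 (F q 2 (q 1)))) (u (F q 1 (F q 0 (q 2)))) (u (F q 2 (F q 1 (q 0))))
    \<le> graph_energy q 2 u"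
proof -
  let ?Q = "25/9 * (reduced_cell_energy (u (q 0)) (u (F q 0 (q 1))) (u (F q 0 (q 2))) (u (F q 0 (F q 2 (q 1))))
    + reduced_cell_energy (u (q 1)) (u (F q 0 (q 1))) (u (F q 1 (q 2))) (u (F q 1 (F q 0 (q 2))))
    + reduced_cell_energy (u (q 2)) (u (F q 0 (q 2))) (u (F q 1 (q 2))) (u (F q 2 (F q 1 (q 0)))))"
  have "?Q \<le> graph_energy q 2 u"
    unfolding graph_energy_2 by (intro mult_left_mono add_mono cell_energy_ge) simp
  with reduced_cell_energy_sum_ge show ?thesis by (rule order_trans)
qed

lemma ex_graph_energy_2_min:
  fixes f :: "real^2 \<Rightarrow> real"
  obtains g where "g (q 0) = f (q 0)" "g (q 1) = f (q 1)" "g (q 2) = f (q 2)"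
    "g (F q 0 (F q 2 (q 1))) = f (F q 0 (F q 2 (q 1)))"
    "g (F q 1 (F q 0 (q 2))) = f (F q 1 (F q 0 (q 2)))"
    "g (F q 2 (F q 1 (q 0))) = f (F q 2 (F q 1 (q 0)))"
    "graph_energy q 2 g = conductance_form (f (q 0)) (f (q 1)) (f (q 2))
      (f (F q 0 (F q 2 (q 1)))) (f (F q 1 (F q 0 (q 2)))) (f (F q 2 (F q 1 (q 0))))"
proof -
  define x0 x1 x2 where "x0 = f (q 0)" and "x1 = f (q 1)" and "x2 = f (q 2)"
  define y0 y1 y2 where "y0 = f (F q 0 (F q 2 (q 1)))" and "y1 = f (F q 1 (F q 0 (q 2)))"
    and "y2 = f (F q 2 (F q 1 (q 0)))"
  define z0 where "z0 = (26 * (x1 + x2) + 104 * (y1 + y2) + x0 + 4 * y0) / 265"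
  define z1 where "z1 = (26 * (x0 + x2) + 104 * (y0 + y2) + x1 + 4 * y1) / 265"
  define z2 where "z2 = (26 * (x0 + x1) + 104 * (y0 + y1) + x2 + 4 * y2) / 265"
  \<comment> \<open>The minimizing midpoint value on the side ab; exchanging \<open>b\<close> and
    \<open>c\<close> gives the one on the side ac.\<close>
  define e where "e a b c d = (5 * a + 5 * d + 4 * b + c) / 15" for a b c d :: real
  \<comment> \<open>The nine vertices outside the six given points are recognised by their first two
    coordinates and receive the minimizing values.\<close>
  define g where "g x = (let s = b 0 x; t = b 1 x in
    if s = 1/2 \<and> t = 1/2 then z2 else if s = 1/2 \<and> t = 0 then z1 else if s = 0 \<and> t = 1/2 then z0
    else if s = 3/4 \<and> t = 1/4 then e x0 z2 z1 y0 else if s = 3/4 \<and> t = 0 then e x0 z1 z2 y0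
    else if s = 1/4 \<and> t = 3/4 then e x1 z2 z0 y1 else if s = 0 \<and> t = 3/4 then e x1 z0 z2 y1
    else if s = 1/4 \<and> t = 0 then e x2 z1 z0 y2 else if s = 0 \<and> t = 1/4 then e x2 z0 z1 y2
    else f x)" for x
  have x: "g (q 0) = x0" "g (q 1) = x1" "g (q 2) = x2"
    by (simp_all add: g_def b_q x0_def x1_def x2_def del: One_nat_def)
  have y: "g (F q 0 (F q 2 (q 1))) = y0" "g (F q 1 (F q 0 (q 2))) = y1" "g (F q 2 (F q 1 (q 0))) = y2"
    by (simp_all add: g_def b_F' b_q y0_def y1_def y2_def del: One_nat_def)
  have z: "g (F q 0 (q 1)) = z2" "g (F q 0 (q 2)) = z1" "g (F q 1 (q 2)) = z0"
    by (simp_all add: g_def b_F' b_q del: One_nat_def)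
  have e: "g (F q 0 (F q 0 (q 1))) = e x0 z2 z1 y0" "g (F q 0 (F q 0 (q 2))) = e x0 z1 z2 y0"
    "g (F q 1 (F q 1 (q 0))) = e x1 z2 z0 y1" "g (F q 1 (F q 1 (q 2))) = e x1 z0 z2 y1"
    "g (F q 2 (F q 2 (q 0))) = e x2 z1 z0 y2" "g (F q 2 (F q 2 (q 1))) = e x2 z0 z1 y2"
    by (simp_all add: g_def b_F' b_q del: One_nat_def)
  have min: "cell_energy a b c d (e a b c d) (e a c b d) = reduced_cell_energy a b c d" for a b c d
    using cell_energy_min[of a b c d] by (simp add: e_def add.commute add.left_commute)
  have "graph_energy q 2 g
      = 25/9 * (reduced_cell_energy x0 z2 z1 y0 + reduced_cell_energy x1 z2 z0 y1 + reduced_cell_energy x2 z1 z0 y2)"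
    unfolding graph_energy_2 x y z e min ..
  also have "\<dots> = conductance_form x0 x1 x2 y0 y1 y2"
    by (rule reduced_cell_energy_sum_min[OF z0_def z1_def z2_def])
  finally show ?thesis
    using x y unfolding x0_def x1_def x2_def y0_def y1_def y2_def by (intro that)
qed

text \<open>The witness is the level-2 spline of the minimizing vertex values. Its energy is that of
  level 2, which bounds every competitor from below.\<close>

lemma ex_least_energy_ext:
  fixes p :: "nat \<Rightarrow> real^2"
  assumes p: "p 2 = F q 2 (F q 1 (q 0))" "p 1 = F q 1 (F q 0 (q 2))" "p 0 = F q 0 (F q 2 (q 1))"
  obtains u where "least_energy_ext q {q 0, q 1, q 2, p 0, p 1, p 2} f u"
    "energy q u = ereal (conductance_form (u (q 0)) (u (q 1)) (u (q 2)) (u (p 0)) (u (p 1)) (u (p 2)))"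
proof -
  obtain g where g: "g (q 0) = f (q 0)" "g (q 1) = f (q 1)" "g (q 2) = f (q 2)"
    "g (p 0) = f (p 0)" "g (p 1) = f (p 1)" "g (p 2) = f (p 2)"
    and E: "graph_energy q 2 g
      = conductance_form (f (q 0)) (f (q 1)) (f (q 2)) (f (p 0)) (f (p 1)) (f (p 2))"
    unfolding p by (rule ex_graph_energy_2_min)
  obtain u where u: "u \<in> dom_energy q" "energy q u = ereal (graph_energy q 2 g)"
    "\<And>x. x \<in> K \<Longrightarrow> u x = spline 2 g x"
    using ex_dom_energy_spline[of 2 g] by blast
  have uq: "u (q i) = g (q i)" if "i < 3" for i
    using that by (simp add: u(3) K_q spline_q del: spline.simps)
  have up: "u (p 0) = g (p 0)" "u (p 1) = g (p 1)" "u (p 2) = g (p 2)"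
    unfolding p by (simp_all add: u(3) K_q K_F spline_2 del: spline.simps One_nat_def)
  have uf: "u (q 0) = f (q 0)" "u (q 1) = f (q 1)" "u (q 2) = f (q 2)"
    "u (p 0) = f (p 0)" "u (p 1) = f (p 1)" "u (p 2) = f (p 2)"
    using uq[of 0] uq[of 1] uq[of 2] up g by auto
  have "energy q u \<le> energy q v" if "\<forall>x\<in>{q 0, q 1, q 2, p 0, p 1, p 2}. v x = f x" for v
  proof -
    have "energy q u = conductance_form (v (q 0)) (v (q 1)) (v (q 2)) (v (p 0)) (v (p 1)) (v (p 2))"
      using that by (simp add: u(2) E)
    also have "\<dots> \<le> ereal (graph_energy q 2 v)"
      using graph_energy_2_ge[of v] by (simp add: p del: One_nat_def)
    also have "\<dots> \<le> energy q v" by (rule graph_energy_le_energy)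
    finally show ?thesis .
  qed
  with u(1) uf have "least_energy_ext q {q 0, q 1, q 2, p 0, p 1, p 2} f u"
    by (auto simp: least_energy_ext_def)
  moreover have "energy q u = ereal (conductance_form (u (q 0)) (u (q 1)) (u (q 2)) (u (p 0)) (u (p 1)) (u (p 2)))"
    unfolding uf u(2) E ..
  ultimately show ?thesis by (rule that)
qed

lemma distinct_points:
  fixes p :: "nat \<Rightarrow> real^2"
  assumes p: "p 2 = F q 2 (F q 1 (q 0))" "p 1 = F q 1 (F q 0 (q 2))" "p 0 = F q 0 (F q 2 (q 1))"
  shows "distinct [q 0, q 1, q 2, p 0, p 1, p 2]"
proof -
  have "distinct (map (\<lambda>x. (b 0 x, b 1 x)) [q 0, q 1, q 2, p 0, p 1, p 2])"
    by (simp add: p b_q b_F' del: One_nat_def)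
  then show ?thesis unfolding distinct_map by blast
qed

end

theorem lemma2p12:
  fixes q p :: "nat \<Rightarrow> real^2" and \<beta>\<^sub>0 :: "(real^2) set"
  assumes "equilateral q"
    and "p 2 = F q 2 (F q 1 (q 0))"
    and "p 1 = F q 1 (F q 0 (q 2))"
    and "p 0 = F q 0 (F q 2 (q 1))"
    and "\<beta>\<^sub>0 = {q 0, q 1, q 2, p 0, p 1, p 2}"
  shows "is_conductances q \<beta>\<^sub>0 (conductance q \<beta>\<^sub>0) \<and>
    (\<forall>i\<in>{0,1,2}. \<forall>j\<in>{0,1,2}. i \<noteq> j \<longrightarrow>
      conductance q \<beta>\<^sub>0 (q i) (p i) = 410/159 \<and>
      conductance q \<beta>\<^sub>0 (q i) (q j) = 5/53 \<and>
      conductance q \<beta>\<^sub>0 (q i) (p j) = 20/53 \<and>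
      conductance q \<beta>\<^sub>0 (p i) (p j) = 80/53)"
proof -
  obtain b where "barycentric q b" using assms(1) by (rule equilateral_barycentric)
  then interpret barycentric q b .
  have dist: "distinct [q 0, q 1, q 2, p 0, p 1, p 2]"
    using assms(2-4) by (rule distinct_points)
  define Q where "Q = {q 0, q 1, q 2}"
  define P where "P = {(q 0, p 0), (q 1, p 1), (q 2, p 2)}"
  \<comment> \<open>Value 0 off the pairs of distinct points is what \<open>is_conductances\<close>
    prescribes; testing both orders in \<open>P\<close> makes \<open>c\<close> symmetric.\<close>
  define c where "c x y =
    (if x = y \<or> x \<notin> \<beta>\<^sub>0 \<or> y \<notin> \<beta>\<^sub>0 then 0
     else if x \<in> Q \<and> y \<in> Q then 5/53 else if x \<notin> Q \<and> y \<notin> Q then 80/53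
     else if (x, y) \<in> P \<or> (y, x) \<in> P then 410/159 else 20/53 :: real)" for x y
  have neq: "q 0 \<noteq> q 1" "q 0 \<noteq> q 2" "q 0 \<noteq> p 0" "q 0 \<noteq> p 1" "q 0 \<noteq> p 2" "q 1 \<noteq> q 2" "q 1 \<noteq> p 0"
    "q 1 \<noteq> p 1" "q 1 \<noteq> p 2" "q 2 \<noteq> p 0" "q 2 \<noteq> p 1" "q 2 \<noteq> p 2" "p 0 \<noteq> p 1" "p 0 \<noteq> p 2" "p 1 \<noteq> p 2"
    using dist by (auto simp del: One_nat_def)
  note neqs = neq neq[symmetric]
  \<comment> \<open>Every pair occurs twice in the double sum, which cancels the factor 1/2.\<close>
  have form: "1/2 * (\<Sum>x\<in>\<beta>\<^sub>0. \<Sum>y\<in>\<beta>\<^sub>0. c x y * (u x - u y)\<^sup>2)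
      = conductance_form (u (q 0)) (u (q 1)) (u (q 2)) (u (p 0)) (u (p 1)) (u (p 2))" for u
  proof -
    have S: "(\<Sum>x\<in>\<beta>\<^sub>0. t x) = t (q 0) + t (q 1) + t (q 2) + t (p 0) + t (p 1) + t (p 2)" for t :: "real^2 \<Rightarrow> real"
      by (simp add: assms(5) neqs add.assoc del: One_nat_def)
    show ?thesis
      unfolding S by (simp add: c_def Q_def P_def assms(5) neqs conductance_form_def power2_commute algebra_simps del: One_nat_def)
  qed
  have c: "is_conductances q \<beta>\<^sub>0 c"
    unfolding is_conductances_def
  proof (intro conjI allI impI)
    show "c x y = c y x" for x y
      unfolding c_def by auto
    show "c x y = 0" if "\<not> (x \<in> \<beta>\<^sub>0 \<and> y \<in> \<beta>\<^sub>0 \<and> x \<noteq> y)" for x y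
      using that unfolding c_def by auto
    show "\<exists>u. least_energy_ext q \<beta>\<^sub>0 f u \<and>
        energy q u = ereal (1/2 * (\<Sum>x\<in>\<beta>\<^sub>0. \<Sum>y\<in>\<beta>\<^sub>0. c x y * (u x - u y)\<^sup>2))" for f
      unfolding form using ex_least_energy_ext[OF assms(2-4), of f] assms(5) by metis
  qed
  have "finite \<beta>\<^sub>0" by (simp add: assms(5))
  with c have "conductance q \<beta>\<^sub>0 = c"
    unfolding conductance_def by (blast intro: the_equality is_conductances_unique)
  with c show ?thesis
    by (simp add: c_def Q_def P_def assms(5) neqs del: One_nat_def)
qed

end
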